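(* For integers $j\ge1$ define functions on $x>-1$ by $f_{0,j}(x)=\ln^j(1+x)$ and $f_{n,j}(x)=\int_0^x f_{n-1,j}(t)\,dt$ for $n\ge1$, and write (uniquely) $$f_{n,j}(x)=A_{n,j}(x)+\sum_{k=1}^{j}B_{n,k,j}(x)\ln^k(1+x)$$ with polynomials $A_{n,j}$, $B_{n,k,j}$. Then for all $n\ge0$ and $j\ge1$, $$A_{n,j}(x)=\frac{(-1)^j\,j!}{n!}\sum_{r=1}^{n}\binom{n}{r}\left[\sum_{k=0}^{r-1}\frac{H_{n-k,j-1}}{n-k}\right]x^r.$$
   Context: For $n\ge0$, $m\ge0$, $H_{n,m}=\sum_{1\le a_1\le a_2\le\cdots\le a_m\le n}\frac{1}{a_1a_2\cdots a_m}$, the sum over all nondecreasing $m$-tuples with entries in $\{1,\dots,n\}$; thus $H_{n,0}=1$ for all $n\ge0$ and $H_{0,m}=0$ for $m\ge1$. *)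

theory Defs
  imports "HOL-Analysis.Analysis" "HOL-Computational_Algebra.Polynomial"
begin

definition H :: "nat \<Rightarrow> nat \<Rightarrow> real" where
  "H n m = (\<Sum>as \<in> {as :: nat list. length as = m \<and> sorted as \<and> set as \<subseteq> {1..n}}.
              1 / real (prod_list as))"

text \<open>
  The interval integral is oriented, so that for \<open>x < 0\<close> it is minus the integral over \<open>[x, 0]\<close>.
  Only the values at \<open>x > -1\<close> are meaningful, and these depend only on values of the integrand
  at points greater than \<open>-1\<close>.
\<close>

primrec f :: "nat \<Rightarrow> nat \<Rightarrow> real \<Rightarrow> real" where
  "f 0 j x = ln (1 + x) ^ j"
| "f (Suc n) j x = (LBINT t=ereal 0..ereal x. f n j t)"

text \<open>
  Only the values of \<open>B\<close> on \<open>{1..j}\<close> are relevant here.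
\<close>

definition log_decomposition :: "nat \<Rightarrow> nat \<Rightarrow> real poly \<Rightarrow> (nat \<Rightarrow> real poly) \<Rightarrow> bool" where
  "log_decomposition n j A B \<longleftrightarrow>
     (\<forall>x > -1. f n j x = poly A x + (\<Sum>k=1..j. poly (B k) x * ln (1 + x) ^ k))"

end

theory Submission
  imports Defs "HOL-Real_Asymp.Real_Asymp"
begin

text \<open>
  In the variable \<open>s\<close>, the exponential generating function of \<open>j \<mapsto> f 0 j x\<close> is \<open>(1 + x) powr s\<close>.
  Its \<open>n\<close>-fold integral from \<open>0\<close> is \<open>(1 + x) powr (s + n) / ((s + 1) \<dots> (s + n))\<close> minus the Taylor
  polynomial of degree \<open>n - 1\<close> of this function at \<open>0\<close>, and \<open>1 / ((s + 1) \<dots> (s + n))\<close> has the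
  coefficients \<open>(-1) ^ m * H n m / fact n\<close>. Comparing coefficients of \<open>s ^ j\<close> gives a closed form
  of \<open>f n j\<close>, in which the coefficient of \<open>x ^ r\<close> in the log-free part is a multiple of
  \<open>H n j - H (n - r) j\<close>; this difference telescopes. Uniqueness holds because powers of \<open>ln (1 + x)\<close>
  are negligible against \<open>x\<close> as \<open>x\<close> tends to infinity, so the leading coefficients of the polynomials
  multiplying them form a polynomial in \<open>ln (1 + x)\<close> that tends to \<open>0\<close>.
\<close>

section \<open>Recurrence and telescoping for the multiple harmonic sums\<close>

lemma finite_sorted_lists: "finite {as :: nat list. length as = m \<and> sorted as \<and> set as \<subseteq> {1..n}}"
  by (rule finite_subset[OF _ finite_lists_length_eq[of "{1..n}" m]]) auto

lemma H_0_right: "H n 0 = 1"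
proof -
  have "{as :: nat list. length as = 0 \<and> sorted as \<and> set as \<subseteq> {1..n}} = {[]}"
    by auto
  then show ?thesis
    by (simp add: H_def)
qed

lemma H_0_Suc: "H 0 (Suc m) = 0"
proof -
  have "{as :: nat list. length as = Suc m \<and> sorted as \<and> set as \<subseteq> {1..0}} = {}"
    by auto
  then show ?thesis
    by (simp add: H_def)
qed

text \<open>Split the sorted lists by whether their last entry is \<open>Suc n\<close>. Deleting
  such an entry leaves an arbitrary sorted list of length \<open>m\<close> over
  \<open>{1..Suc n}\<close>.\<close>

lemma H_Suc_Suc: "H (Suc n) (Suc m) = H n (Suc m) + H (Suc n) m / real (Suc n)"
proof -
  define S where "S n m = {as :: nat list. length as = m \<and> sorted as \<and> set as \<subseteq> {1..n}}" for n m
  let ?app = "\<lambda>bs. bs @ [Suc n]"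
  have fin: "finite (S n m)" for n m
    unfolding S_def by (rule finite_sorted_lists)
  have H: "H n m = (\<Sum>as\<in>S n m. 1 / real (prod_list as))" for n m
    by (simp add: H_def S_def)
  have split: "S (Suc n) (Suc m) = S n (Suc m) \<union> ?app ` S (Suc n) m"
  proof (intro equalityI subsetI)
    fix as assume as: "as \<in> S (Suc n) (Suc m)"
    then have "as \<noteq> []"
      by (auto simp: S_def)
    then obtain bs b where [simp]: "as = bs @ [b]"
      by (metis append_butlast_last_id)
    show "as \<in> S n (Suc m) \<union> ?app ` S (Suc n) m"
    proof (cases "b = Suc n")
      case True
      then show ?thesis
        using as by (auto simp: S_def sorted_append)
    next
      case False
      then have "b \<le> n"
        using as by (auto simp: S_def)
      then have "as \<in> S n (Suc m)"
        using as by (fastforce simp: S_def sorted_append)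
      then show ?thesis ..
    qed
  next
    fix as assume "as \<in> S n (Suc m) \<union> ?app ` S (Suc n) m"
    then show "as \<in> S (Suc n) (Suc m)"
      by (fastforce simp: S_def sorted_append)
  qed
  have "S n (Suc m) \<inter> ?app ` S (Suc n) m = {}"
    by (auto simp: S_def)
  then have "H (Suc n) (Suc m) =
      H n (Suc m) + (\<Sum>as\<in>?app ` S (Suc n) m. 1 / real (prod_list as))"
    unfolding H split by (intro sum.union_disjoint fin finite_imageI)
  also have "(\<Sum>as\<in>?app ` S (Suc n) m. 1 / real (prod_list as)) = H (Suc n) m / real (Suc n)"
    by (subst sum.reindex) (auto simp: inj_on_def H sum_divide_distrib algebra_simps)
  finally show ?thesis .
qed

text \<open>By the recurrence each summand is
  \<open>H (n - k) (Suc m) - H (n - Suc k) (Suc m)\<close>.\<close>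

lemma sum_H_telescope:
  "r \<le> n \<Longrightarrow> (\<Sum>k<r. H (n - k) m / real (n - k)) = H n (Suc m) - H (n - r) (Suc m)"
proof (induction r)
  case (Suc r)
  then have "n - r = Suc (n - Suc r)"
    by simp
  then have "H (n - r) (Suc m) = H (n - Suc r) (Suc m) + H (n - r) m / real (n - r)"
    by (metis H_Suc_Suc)
  with Suc show ?case
    by simp
qed simp

section \<open>Coefficients of the reciprocal rising factorial\<close>

text \<open>The coefficient of \<open>s ^ m\<close> in \<open>1 / ((s + 1) \<dots> (s + n))\<close>.\<close>

definition rising_coeff :: "nat \<Rightarrow> nat \<Rightarrow> real" where
  "rising_coeff n m = (-1) ^ m * H n m / fact n"

lemma rising_coeff_0_left: "rising_coeff 0 m = (if m = 0 then 1 else 0)"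
  by (cases m) (simp_all add: rising_coeff_def H_0_right H_0_Suc)

lemma rising_coeff_Suc_0: "real (Suc n) * rising_coeff (Suc n) 0 = rising_coeff n 0"
  by (simp add: rising_coeff_def H_0_right divide_simps)

text \<open>Multiplying \<open>1 / ((s + 1) \<dots> (s + Suc n))\<close> by \<open>s + Suc n\<close>
  cancels the last factor; compare coefficients of \<open>s ^ Suc m\<close>.\<close>

lemma rising_coeff_Suc_Suc:
  "real (Suc n) * rising_coeff (Suc n) (Suc m) + rising_coeff (Suc n) m = rising_coeff n (Suc m)"
proof -
  have *: "N * (- e * (a + b / N) / (N * d)) + e * b / (N * d) = - e * a / d"
    if "N \<noteq> 0" "d \<noteq> 0" for N d e a b :: real
    using that by (simp add: divide_simps) algebra
  show ?thesis
    using *[of "real (Suc n)" "fact n" "(-1) ^ m" "H n (Suc m)" "H (Suc n) m"]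
    unfolding rising_coeff_def H_Suc_Suc[of n m] fact_Suc by (simp del: of_nat_Suc)
qed

section \<open>The logarithmic part and its derivative\<close>

text \<open>The coefficient of \<open>s ^ j\<close> in \<open>(1 + x) powr s / ((s + 1) \<dots> (s + n))\<close>.\<close>

definition log_part :: "nat \<Rightarrow> nat \<Rightarrow> real \<Rightarrow> real" where
  "log_part n j x = (\<Sum>k\<le>j. rising_coeff n k * (ln (1 + x) ^ (j - k) / fact (j - k)))"

lemma log_part_Suc_0: "real (Suc n) * log_part (Suc n) 0 x = log_part n 0 x"
  using rising_coeff_Suc_0[of n] by (simp add: log_part_def)

text \<open>The same cancellation of \<open>s + Suc n\<close>, after multiplication by
  \<open>(1 + x) powr s\<close>.\<close>

lemma log_part_Suc_Suc:
  "real (Suc n) * log_part (Suc n) (Suc j) x + log_part (Suc n) j x = log_part n (Suc j) x"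
proof -
  let ?l = "\<lambda>k. ln (1 + x) ^ k / fact k"
  have "real (Suc n) * log_part (Suc n) (Suc j) x + log_part (Suc n) j x =
      real (Suc n) * rising_coeff (Suc n) 0 * ?l (Suc j) +
      (\<Sum>k\<le>j. (real (Suc n) * rising_coeff (Suc n) (Suc k) + rising_coeff (Suc n) k) * ?l (j - k))"
    unfolding log_part_def sum.atMost_Suc_shift
    by (simp add: sum_distrib_left distrib_left distrib_right sum.distrib mult.assoc
        add_divide_distrib)
  also have "\<dots> = log_part n (Suc j) x"
    unfolding rising_coeff_Suc_0 rising_coeff_Suc_Suc log_part_def sum.atMost_Suc_shift by simp
  finally show ?thesis .
qed

lemma log_part_0_right: "log_part n j 0 = rising_coeff n j"
proof -
  \<comment> \<open>Since \<open>ln 1 = 0\<close>, only \<open>k = j\<close> survives, through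
    \<open>0 ^ 0 = 1\<close>.\<close>
  have "log_part n j 0 = (\<Sum>k\<le>j. if k = j then rising_coeff n k else 0)"
    unfolding log_part_def by (intro sum.cong) auto
  then show ?thesis
    by simp
qed

lemma DERIV_log_part_0: "(log_part n 0 has_real_derivative 0) (at x)"
  unfolding log_part_def by simp

text \<open>Differentiating \<open>(1 + x) powr s\<close> multiplies it by
  \<open>s / (1 + x)\<close>, and the factor \<open>s\<close> shifts the coefficient index by
  one.\<close>

lemma DERIV_log_part_Suc:
  assumes "x > -1"
  shows "(log_part n (Suc j) has_real_derivative log_part n j x / (1 + x)) (at x)"
proof -
  have *: "((\<lambda>x. ln (1 + x) ^ Suc i / fact (Suc i)) has_real_derivative
      ln (1 + x) ^ i / fact i / (1 + x)) (at x)" for i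
  proof -
    have "((\<lambda>x. ln (1 + x) ^ Suc i / fact (Suc i)) has_real_derivative
        real (Suc i) * ln (1 + x) ^ i * (1 / (1 + x)) / fact (Suc i)) (at x)"
      using assms by (auto intro!: derivative_eq_intros simp del: power_Suc fact_Suc)
    then show ?thesis
      unfolding fact_Suc by (simp del: of_nat_Suc power_Suc add: mult.commute)
  qed
  \<comment> \<open>The summand \<open>k = Suc j\<close> carries no logarithm and is constant in
    \<open>x\<close>.\<close>
  have "((\<lambda>x. (\<Sum>k\<le>j. rising_coeff n k * (ln (1 + x) ^ Suc (j - k) / fact (Suc (j - k)))) +
        rising_coeff n (Suc j)) has_real_derivative
      (\<Sum>k\<le>j. rising_coeff n k * (ln (1 + x) ^ (j - k) / fact (j - k) / (1 + x))) + 0) (at x)"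
    by (intro DERIV_add DERIV_sum DERIV_cmult * DERIV_const)
  then show ?thesis
    by (simp add: log_part_def[abs_def] Suc_diff_le sum_divide_distrib del: power_Suc fact_Suc)
qed

text \<open>The product rule produces exactly the left-hand side of the recurrence for
  \<open>log_part\<close>, times \<open>(1 + x) ^ n\<close>.\<close>

lemma DERIV_power_log_part:
  assumes "x > -1"
  shows "((\<lambda>x. (1 + x) ^ Suc n * log_part (Suc n) j x) has_real_derivative
    (1 + x) ^ n * log_part n j x) (at x)"
proof (cases j)
  case 0
  have "((\<lambda>x. (1 + x) ^ Suc n * log_part (Suc n) 0 x) has_real_derivative
      (1 + x) ^ n * (real (Suc n) * log_part (Suc n) 0 x)) (at x)"
    by (rule derivative_eq_intros DERIV_log_part_0 | simp)+
  then show ?thesis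
    unfolding log_part_Suc_0 0 .
next
  case (Suc i)
  have "((\<lambda>x. (1 + x) ^ Suc n * log_part (Suc n) (Suc i) x) has_real_derivative
      (1 + x) ^ n * (real (Suc n) * log_part (Suc n) (Suc i) x + log_part (Suc n) i x)) (at x)"
    by (rule derivative_eq_intros DERIV_log_part_Suc[OF assms] refl)+
       (use assms in \<open>simp add: field_simps del: of_nat_Suc\<close>)
  then show ?thesis
    unfolding log_part_Suc_Suc Suc .
qed

section \<open>The Taylor part and the closed form of the iterated integrals\<close>

text \<open>The \<open>r\<close>-th derivative of
  \<open>(1 + x) powr (s + n) / ((s + 1) \<dots> (s + n))\<close> at \<open>0\<close> is
  \<open>1 / ((s + 1) \<dots> (s + n - r))\<close>, hence the coefficient
  \<open>rising_coeff (n - r) j\<close>.\<close>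

definition taylor_part :: "nat \<Rightarrow> nat \<Rightarrow> real \<Rightarrow> real" where
  "taylor_part n j x = (\<Sum>r<n. rising_coeff (n - r) j * (x ^ r / fact r))"

lemma DERIV_taylor_part: "(taylor_part (Suc n) j has_real_derivative taylor_part n j x) (at x)"
proof -
  have *: "((\<lambda>x. x ^ Suc i / fact (Suc i)) has_real_derivative x ^ i / fact i) (at x)"
    for i and x :: real
  proof -
    have "((\<lambda>x. x ^ Suc i / fact (Suc i)) has_real_derivative
        real (Suc i) * x ^ i / fact (Suc i)) (at x)"
      by (auto intro!: derivative_eq_intros simp del: power_Suc fact_Suc)
    then show ?thesis
      unfolding fact_Suc by (simp del: of_nat_Suc power_Suc)
  qed
  have "((\<lambda>x. rising_coeff (Suc n) j +
        (\<Sum>r<n. rising_coeff (n - r) j * (x ^ Suc r / fact (Suc r)))) has_real_derivative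
      0 + (\<Sum>r<n. rising_coeff (n - r) j * (x ^ r / fact r))) (at x)"
    by (intro DERIV_add DERIV_sum DERIV_cmult * DERIV_const)
  then show ?thesis
    by (simp add: taylor_part_def[abs_def] sum.lessThan_Suc_shift del: power_Suc fact_Suc
        sum.lessThan_Suc)
qed

text \<open>Induction on \<open>n\<close>: the right-hand side for \<open>Suc n\<close> is an
  antiderivative of the one for \<open>n\<close> and vanishes at \<open>0\<close>. The factor
  \<open>fact j\<close> undoes the normalization of the exponential generating function.\<close>

lemma f_closed_form:
  assumes "x > -1"
  shows "f n j x = fact j * ((1 + x) ^ n * log_part n j x - taylor_part n j x)"
  using assms
proof (induction n arbitrary: x)
  case 0
  have "log_part 0 j x = (\<Sum>k\<le>j. if k = 0 then ln (1 + x) ^ j / fact j else 0)"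
    unfolding log_part_def by (intro sum.cong) (auto simp: rising_coeff_0_left)
  then show ?case
    by (simp add: taylor_part_def)
next
  case (Suc n)
  define F where "F m y = fact j * ((1 + y) ^ m * log_part m j y - taylor_part m j y)" for m y
  have F: "(F (Suc n) has_real_derivative f n j y) (at y)" if "y > -1" for y
    unfolding Suc.IH[OF that] F_def
    by (intro DERIV_cmult DERIV_diff DERIV_power_log_part DERIV_taylor_part that)
  have cont_log: "isCont (log_part n j) y" if "y > -1" for y
    using that
    by (cases j) (auto intro: DERIV_isCont[OF DERIV_log_part_0] DERIV_isCont[OF DERIV_log_part_Suc])
  \<comment> \<open>The bounds \<open>min 0 x\<close> and \<open>max 0 x\<close> cover both signs of
    \<open>x\<close>; the interval stays to the right of \<open>-1\<close>, where the induction
    hypothesis applies.\<close>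
  have cont: "continuous_on {min 0 x..max 0 x} (f n j)"
  proof -
    have "isCont (F n) y" if "y > -1" for y
      unfolding F_def taylor_part_def using cont_log[OF that] by (intro continuous_intros) auto
    then have "continuous_on {min 0 x..max 0 x} (F n)"
      using Suc.prems by (intro continuous_at_imp_continuous_on) auto
    moreover have "F n y = f n j y" if "y \<in> {min 0 x..max 0 x}" for y
      using Suc.prems Suc.IH[of y] that by (auto simp: F_def)
    ultimately show ?thesis
      by (rule continuous_on_eq)
  qed
  have "f (Suc n) j x = F (Suc n) x - F (Suc n) 0"
    unfolding f.simps
  proof (rule interval_integral_FTC_finite[OF cont])
    fix y assume "min 0 x \<le> y" "y \<le> max 0 x"
    then have "y > -1"
      using Suc.prems by auto
    then have "(F (Suc n) has_vector_derivative f n j y) (at y)"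
      by (rule F[unfolded has_real_derivative_iff_has_vector_derivative])
    then show "(F (Suc n) has_vector_derivative f n j y) (at y within {min 0 x..max 0 x})"
      by (rule has_vector_derivative_at_within)
  qed
  \<comment> \<open>At \<open>0\<close> the value of \<open>log_part\<close> is the
    \<open>r = 0\<close> term of \<open>taylor_part\<close>; the other terms contain a positive
    power of \<open>0\<close>.\<close>
  moreover have "F (Suc n) 0 = 0"
    by (simp add: F_def log_part_0_right taylor_part_def sum.lessThan_Suc_shift
        del: sum.lessThan_Suc)
  ultimately show ?case
    by (simp add: F_def del: f.simps)
qed

section \<open>An explicit decomposition and its log-free polynomial\<close>

text \<open>The log-free summand \<open>k = j\<close> of \<open>log_part\<close>, times
  \<open>(1 + x) ^ n\<close>, minus the Taylor part.\<close>

definition closed_A :: "nat \<Rightarrow> nat \<Rightarrow> real poly" where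
  "closed_A n j = smult (fact j)
     (smult (rising_coeff n j) ([:1, 1:] ^ n) - (\<Sum>r<n. monom (rising_coeff (n - r) j / fact r) r))"

definition closed_B :: "nat \<Rightarrow> nat \<Rightarrow> nat \<Rightarrow> real poly" where
  "closed_B n j k = smult (fact j * rising_coeff n (j - k) / fact k) ([:1, 1:] ^ n)"

lemma log_decomposition_closed: "log_decomposition n j (closed_A n j) (closed_B n j)"
  unfolding log_decomposition_def
proof (intro allI impI)
  fix x :: real assume x: "x > -1"
  let ?t = "\<lambda>k. rising_coeff n (j - k) * (ln (1 + x) ^ k / fact k)"
  \<comment> \<open>Reversing the sum makes the index the exponent of the logarithm.\<close>
  have "log_part n j x = (\<Sum>k\<le>j. ?t k)"
    unfolding log_part_def
    by (rule sum.reindex_bij_witness[of _ "\<lambda>k. j - k" "\<lambda>k. j - k"]) auto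
  also have "\<dots> = ?t 0 + (\<Sum>k=1..j. ?t k)"
    by (simp add: atMost_atLeast0 sum.atLeast_Suc_atMost)
  finally show "f n j x = poly (closed_A n j) x + (\<Sum>k=1..j. poly (closed_B n j k) x * ln (1 + x) ^ k)"
    by (simp add: f_closed_form[OF x] closed_A_def closed_B_def taylor_part_def poly_sum
        poly_monom algebra_simps sum_distrib_left)
qed

text \<open>Expand \<open>(1 + x) ^ n\<close> binomially and use
  \<open>1 / (fact r * fact (n - r)) = (n choose r) / fact n\<close>: the coefficient of
  \<open>x ^ r\<close> becomes a multiple of \<open>H n j - H (n - r) j\<close>.\<close>

lemma poly_closed_A:
  assumes "j \<ge> 1"
  shows "poly (closed_A n j) x = (-1) ^ j * fact j / fact n *
    (\<Sum>r=1..n. real (n choose r) * (\<Sum>k=0..r - 1. H (n - k) (j - 1) / real (n - k)) * x ^ r)"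
proof -
  obtain m where j: "j = Suc m"
    using assms by (cases j) auto
  let ?h = "\<lambda>r. real (n choose r) * (H n j - H (n - r) j) * x ^ r"
  \<comment> \<open>The added term \<open>r = n\<close> is zero because
    \<open>rising_coeff 0 j = 0\<close> for positive \<open>j\<close>.\<close>
  have "(\<Sum>r<n. rising_coeff (n - r) j / fact r * x ^ r) =
      (\<Sum>r\<le>n. rising_coeff (n - r) j / fact r * x ^ r)"
    by (simp add: lessThan_Suc_atMost[symmetric] rising_coeff_0_left j)
  moreover have "(1 + x) ^ n = (\<Sum>r\<le>n. real (n choose r) * x ^ r)"
    using binomial_ring[of x 1 n] by (simp add: add.commute)
  ultimately have "poly (closed_A n j) x = fact j *
      (\<Sum>r\<le>n. rising_coeff n j * (real (n choose r) * x ^ r) - rising_coeff (n - r) j / fact r * x ^ r)"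
    by (simp add: closed_A_def poly_sum poly_monom sum_subtractf sum_distrib_left)
  also have "\<dots> = fact j * (\<Sum>r\<le>n. (-1) ^ j / fact n * ?h r)"
    by (intro arg_cong2[of _ _ _ _ "(*)"] sum.cong refl)
       (simp add: rising_coeff_def binomial_fact field_simps)
  \<comment> \<open>The term \<open>r = 0\<close> drops out, its difference of harmonic sums being
    zero.\<close>
  also have "\<dots> = (-1) ^ j * fact j / fact n * (\<Sum>r=1..n. ?h r)"
    unfolding sum_distrib_left[symmetric] by (simp add: atMost_atLeast0 sum.atLeast_Suc_atMost)
  also have "(\<Sum>r=1..n. ?h r) =
      (\<Sum>r=1..n. real (n choose r) * (\<Sum>k=0..r - 1. H (n - k) (j - 1) / real (n - k)) * x ^ r)"
  proof (intro sum.cong refl arg_cong2[of _ _ _ _ "(*)"])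
    fix r assume "r \<in> {1..n}"
    then have "{0..r - 1} = {..<r}" "r \<le> n"
      by auto
    then show "H n j - H (n - r) j = (\<Sum>k=0..r - 1. H (n - k) (j - 1) / real (n - k))"
      unfolding j diff_Suc_1 using sum_H_telescope[of r n m] by simp
  qed
  finally show ?thesis .
qed

section \<open>Independence of powers of the logarithm, and uniqueness\<close>

lemma poly_tendsto_0_imp_0:
  fixes p :: "real poly"
  assumes "(poly p \<longlongrightarrow> 0) at_top"
  shows "p = 0"
proof (rule ccontr)
  assume "p \<noteq> 0"
  have "degree p = 0"
  proof (rule ccontr)
    assume "degree p \<noteq> 0"
    then have "filterlim (poly p) at_infinity at_infinity"
      by (intro filterlim_poly_at_infinity) simp
    then have "filterlim (poly p) at_infinity at_top"
      by (rule filterlim_mono) (auto simp: at_top_le_at_infinity)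
    with assms show False
      using not_tendsto_and_filterlim_at_infinity[OF trivial_limit_at_top_linorder] by blast
  qed
  then obtain c where "p = [:c:]"
    by (rule degree_eq_zeroE)
  then have "poly p = (\<lambda>_. c)"
    by auto
  with assms have "c = 0"
    by (simp add: tendsto_const_iff)
  with \<open>p \<noteq> 0\<close> \<open>p = [:c:]\<close> show False
    by simp
qed

lemma poly_ln_power_independent:
  fixes P :: "nat \<Rightarrow> real poly"
  assumes zero: "\<And>x. x > -1 \<Longrightarrow> (\<Sum>k\<le>j. poly (P k) x * ln (1 + x) ^ k) = 0"
    and "k \<le> j"
  shows "P k = 0"
proof -
  \<comment> \<open>Here \<open>d\<close> is a common strict bound on the exponents that occur in
    the \<open>P k\<close>; the induction lowers it one at a time down to \<open>0\<close>.\<close>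
  have vanish: "coeff (P k) i = 0"
    if "\<And>k i. k \<le> j \<Longrightarrow> i \<ge> d \<Longrightarrow> coeff (P k) i = 0" "k \<le> j" for d k i
    using that
  proof (induction d arbitrary: k i)
    case (Suc d)
    define q where "q = (\<Sum>k\<le>j. monom (coeff (P k) d) k)"
    have P: "poly (P k) x = (\<Sum>i<d. coeff (P k) i * x ^ i) + coeff (P k) d * x ^ d"
      if "k \<le> j" for k x
    proof -
      have "degree (P k) \<le> d"
        by (rule degree_le) (use Suc.prems(1) that in auto)
      then have "poly (P k) x = poly (\<Sum>i\<le>d. monom (coeff (P k) i) i) x"
        by (simp only: poly_as_sum_of_monoms')
      then have "poly (P k) x = (\<Sum>i\<le>d. coeff (P k) i * x ^ i)"
        by (simp only: poly_sum poly_monom)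
      then show ?thesis
        by (simp add: lessThan_Suc_atMost[symmetric])
    qed
    have lim: "((\<lambda>x. coeff (P k) i * (ln (1 + x) ^ k / x ^ (d - i))) \<longlongrightarrow> 0) at_top"
      if "i < d" for k i
    proof -
      have "d - i > 0"
        using that by simp
      then have "((\<lambda>x::real. ln (1 + x) ^ k / x ^ (d - i)) \<longlongrightarrow> 0) at_top"
        by real_asymp
      then show ?thesis
        by (rule tendsto_mult_right_zero)
    qed
    \<comment> \<open>After division of the identity by \<open>x ^ d\<close>, the terms with
      \<open>i < d\<close> tend to \<open>0\<close>, and their negative equals \<open>q\<close>
      evaluated at \<open>ln (1 + x)\<close>.\<close>
    have "((\<lambda>x. - (\<Sum>k\<le>j. \<Sum>i<d. coeff (P k) i * (ln (1 + x) ^ k / x ^ (d - i)))) \<longlongrightarrow>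
        - (\<Sum>k\<le>j. \<Sum>i<d. 0)) at_top"
      by (intro tendsto_minus tendsto_sum lim) simp
    moreover have "eventually (\<lambda>x. - (\<Sum>k\<le>j. \<Sum>i<d. coeff (P k) i * (ln (1 + x) ^ k / x ^ (d - i))) =
        poly q (ln (1 + x))) at_top"
      using eventually_gt_at_top[of 0]
    proof eventually_elim
      case (elim x)
      have "0 = (\<Sum>k\<le>j. poly (P k) x * ln (1 + x) ^ k) / x ^ d"
        using zero[of x] elim by simp
      also have "\<dots> = (\<Sum>k\<le>j. (\<Sum>i<d. coeff (P k) i * (ln (1 + x) ^ k / x ^ (d - i))) +
          coeff (P k) d * ln (1 + x) ^ k)"
        unfolding sum_divide_distrib
      proof (intro sum.cong refl)
        fix k assume "k \<in> {..j}"
        have "c * x ^ i * l / x ^ d = c * (l / x ^ (d - i))" if "i < d" for i c l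
        proof -
          have "x ^ d = x ^ i * x ^ (d - i)"
            using that by (simp flip: power_add)
          then show ?thesis
            using elim by simp
        qed
        then have "(\<Sum>i<d. coeff (P k) i * x ^ i * ln (1 + x) ^ k / x ^ d) =
            (\<Sum>i<d. coeff (P k) i * (ln (1 + x) ^ k / x ^ (d - i)))"
          by (intro sum.cong refl) blast
        then show "poly (P k) x * ln (1 + x) ^ k / x ^ d =
            (\<Sum>i<d. coeff (P k) i * (ln (1 + x) ^ k / x ^ (d - i))) + coeff (P k) d * ln (1 + x) ^ k"
          using \<open>k \<in> {..j}\<close> elim
          by (simp add: P distrib_right add_divide_distrib sum_distrib_right sum_divide_distrib)
      qed
      finally show ?case
        by (simp add: q_def poly_sum poly_monom sum.distrib)
    qed
    ultimately have "((\<lambda>x. poly q (ln (1 + x))) \<longlongrightarrow> - (\<Sum>k\<le>j. \<Sum>i<d. 0)) at_top"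
      by (rule Lim_transform_eventually)
    then have "((\<lambda>x. poly q (ln (1 + x))) \<longlongrightarrow> 0) at_top"
      by simp
    \<comment> \<open>The substitution \<open>x = exp y - 1\<close> turns \<open>ln (1 + x)\<close>
      into the free variable \<open>y\<close>.\<close>
    moreover have "filterlim (\<lambda>y::real. exp y - 1) at_top at_top"
      by real_asymp
    ultimately have "((\<lambda>y. poly q (ln (1 + (exp y - 1)))) \<longlongrightarrow> 0) at_top"
      by (rule filterlim_compose)
    then have "q = 0"
      by (intro poly_tendsto_0_imp_0) simp
    have "coeff (P k) d = 0" if "k \<le> j" for k
    proof -
      have "coeff q k = coeff (P k) d"
        using that by (simp add: q_def coeff_sum)
      with \<open>q = 0\<close> show ?thesis
        by simp
    qed
    then have "coeff (P k) i = 0" if "k \<le> j" "i \<ge> d" for k i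
      using Suc.prems(1)[of k i] that by (cases "i = d") auto
    then show ?case
      using Suc.IH Suc.prems(2) by blast
  qed simp
  \<comment> \<open>The sum of all degrees bounds each of them and provides a starting value for
    \<open>d\<close>.\<close>
  have "coeff (P k) i = 0" if "k \<le> j" "i \<ge> Suc (\<Sum>k\<le>j. degree (P k))" for k i
  proof -
    have "degree (P k) \<le> (\<Sum>k\<le>j. degree (P k))"
      using that by (intro member_le_sum) auto
    then show ?thesis
      using that by (intro coeff_eq_0) simp
  qed
  then have "coeff (P k) i = 0" for i
    using \<open>k \<le> j\<close> by (rule vanish)
  then show ?thesis
    by (simp add: poly_eq_iff)
qed

lemma log_decomposition_unique:
  assumes "log_decomposition n j A B" "log_decomposition n j A' B'"
  shows "A = A' \<and> (\<forall>k\<in>{1..j}. B k = B' k)"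
proof -
  \<comment> \<open>Subtracting the two decompositions gives a vanishing combination, with
    \<open>A - A'\<close> as the coefficient of the zeroth power.\<close>
  define P where "P k = (if k = 0 then A - A' else B k - B' k)" for k
  have "P k = 0" if "k \<le> j" for k
  proof (rule poly_ln_power_independent[OF _ that])
    fix x :: real assume "x > -1"
    then have "poly A x + (\<Sum>k=1..j. poly (B k) x * ln (1 + x) ^ k) =
        poly A' x + (\<Sum>k=1..j. poly (B' k) x * ln (1 + x) ^ k)"
      using assms by (simp add: log_decomposition_def)
    then show "(\<Sum>k\<le>j. poly (P k) x * ln (1 + x) ^ k) = 0"
      by (simp add: P_def atMost_atLeast0 sum.atLeast_Suc_atMost left_diff_distrib sum_subtractf)
  qed
  then show ?thesis
    by (force simp: P_def split: if_splits)
qed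

theorem theorem5p4:
  fixes n j :: nat
  assumes "j \<ge> 1"
  shows "(\<exists>A B. log_decomposition n j A B) \<and>
    (\<forall>A B A' B'. log_decomposition n j A B \<longrightarrow> log_decomposition n j A' B' \<longrightarrow>
       A = A' \<and> (\<forall>k\<in>{1..j}. B k = B' k)) \<and>
    (\<forall>A B. log_decomposition n j A B \<longrightarrow>
       (\<forall>x::real. poly A x =
          (-1) ^ j * fact j / fact n *
          (\<Sum>r=1..n. real (n choose r) *
             (\<Sum>k=0..r - 1. H (n - k) (j - 1) / real (n - k)) * x ^ r)))"
proof (intro conjI)
  show "\<forall>A B. log_decomposition n j A B \<longrightarrow>
       (\<forall>x::real. poly A x =
          (-1) ^ j * fact j / fact n *
          (\<Sum>r=1..n. real (n choose r) *
             (\<Sum>k=0..r - 1. H (n - k) (j - 1) / real (n - k)) * x ^ r))"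
    \<comment> \<open>By uniqueness every admissible \<open>A\<close> equals
      \<open>closed_A n j\<close>, whose values are known.\<close>
    using log_decomposition_unique[OF _ log_decomposition_closed] poly_closed_A[OF assms] by fast
qed (use log_decomposition_closed log_decomposition_unique in fast)+

end
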